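(* Let $\mathcal{H}$ be a finite hypergraph without isolated vertices whose largest edge has size $k$, and let $\mathcal{E}(\mathcal{H},z)$ be its edge cover polynomial. Then: (i) $\mathcal{E}(\mathcal{H},z)\neq 0$ for every $z\in\mathbb{C}$ with $|z|>2^{k}$; (ii) if moreover $k=2$, then $\mathcal{E}(\mathcal{H},z)\neq 0$ for every $z\in\mathbb{C}$ with $|z|\ge 4$.
   Context: A hypergraph $\mathcal{H}=(V,E)$ consists of a finite vertex set $V$ and a finite collection $E$ of nonempty subsets of $V$ (the edges; repeated edges are allowed); the size of an edge is its number of vertices. A vertex is isolated if it is contained in no edge. A subset $F\subseteq E$ is an edge cover if each vertex of $\mathcal{H}$ is contained in at least one edge of $F$. The edge cover polynomial is $\mathcal{E}(\mathcal{H},z)=\sum_{F\subseteq E\text{ edge cover}} z^{|F|}$. *)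

theory Defs
  imports Complex_Main "HOL-Computational_Algebra.Polynomial"
begin

(* Edges are labels e in E with vertex set ends e; ends need not be injective,
   so repeated edges are allowed and are counted separately. *)
locale hypergraph =
  fixes V :: "'v set" and E :: "'e set" and ends :: "'e \<Rightarrow> 'v set"
  assumes finite_vertices: "finite V"
    and finite_edges: "finite E"
    and ends_subset: "e \<in> E \<Longrightarrow> ends e \<subseteq> V"
    and ends_nonempty: "e \<in> E \<Longrightarrow> ends e \<noteq> {}"

definition isolated :: "'e set \<Rightarrow> ('e \<Rightarrow> 'v set) \<Rightarrow> 'v \<Rightarrow> bool" where
  "isolated E ends v \<longleftrightarrow> \<not> (\<exists>e\<in>E. v \<in> ends e)"

definition edge_cover :: "'v set \<Rightarrow> 'e set \<Rightarrow> ('e \<Rightarrow> 'v set) \<Rightarrow> 'e set \<Rightarrow> bool" where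
  "edge_cover V E ends F \<longleftrightarrow> F \<subseteq> E \<and> (\<forall>v\<in>V. \<exists>e\<in>F. v \<in> ends e)"

definition edge_cover_poly :: "'v set \<Rightarrow> 'e set \<Rightarrow> ('e \<Rightarrow> 'v set) \<Rightarrow> complex poly" where
  "edge_cover_poly V E ends = (\<Sum>F | edge_cover V E ends F. monom 1 (card F))"

(* No k qualifies when E is empty. *)
definition largest_edge_size :: "'e set \<Rightarrow> ('e \<Rightarrow> 'v set) \<Rightarrow> nat \<Rightarrow> bool" where
  "largest_edge_size E ends k \<longleftrightarrow>
     (\<exists>e\<in>E. card (ends e) = k) \<and> (\<forall>e\<in>E. card (ends e) \<le> k)"

end

theory Submission
  imports Defs "HOL-Computational_Algebra.Fundamental_Theorem_Algebra"
begin

text \<open>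
  Inclusion and exclusion over the set \<open>S\<close> of uncovered vertices turns the value of the edge cover
  polynomial at \<open>z\<close> into the sum over \<open>S \<subseteq> V\<close> of \<open>(-1) ^ card S\<close> times one factor per edge,
  which is \<open>1 + z\<close> for an edge that avoids \<open>S\<close> and 1 for any other edge. Two unrelated
  arguments show that this sum does not vanish, where \<open>k\<close> bounds the edge sizes.

  If \<open>norm z \<ge> 2 ^ k\<close> and \<open>z \<noteq> -(2 ^ k)\<close>, start from the sum in which each edge \<open>e\<close> has the factor
  \<open>a e ^ card (ends e \<inter> S)\<close> with a parameter \<open>a e\<close> in the open unit disc. It equals the product
  over the vertices of 1 minus the product of the parameters of the incident edges, and so it is
  nonzero when no vertex is isolated. Then replace these factors by the correct ones, one edge at a
  time, as in Asano contractions and the Lee-Yang theorem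
  (\<open>partially_contracted_sum_nonzero\<close>). As a polynomial \<open>q\<close> in the parameter of one edge, the sum
  has degree at most \<open>k\<close> and no zero in the unit disc, and the replacement yields
  \<open>q(1) + z q(0)\<close>. Factoring \<open>q\<close> into linear factors shows that \<open>q(1)\<close> is \<open>c q(0)\<close> with
  \<open>norm c \<le> 2 ^ k\<close>, and that \<open>c = 2 ^ k\<close> is the only case of equality
  (\<open>zero_free_disc_ratio\<close>).

  The point \<open>z = -(2 ^ k)\<close> with \<open>k \<ge> 2\<close> is on the boundary of what the first argument can reach.
  There the negated edge factors, as functions of \<open>S\<close>, have nonnegative Fourier coefficients with
  respect to the characters \<open>(-1) ^ card (\<tau> \<inter> S)\<close>, and the sum in question is, up to sign and a
  power of two, the coefficient of their product at \<open>\<tau> = V\<close>. There is no cancellation, so this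
  coefficient is positive as soon as one combination of terms contributes to it
  (\<open>fourier_coeff_pos\<close>). Such a combination selects a nonempty subset of each edge, possibly empty
  for an edge with a single vertex, such that each vertex is selected an odd number of times. It
  exists because a connected hypergraph admits every parity condition except at most one, and the
  condition that all vertices are odd is not the exception once there is an edge
  (\<open>parity_pattern_grow\<close>).
\<close>

section \<open>Inclusion and exclusion over the uncovered vertices\<close>

lemma sum_Pow_prod:
  fixes f :: "'a \<Rightarrow> 'b::comm_semiring_1"
  assumes "finite A"
  shows "(\<Sum>S\<in>Pow A. \<Prod>v\<in>S. f v) = (\<Prod>v\<in>A. 1 + f v)"
  using prod_add[OF assms, of f "\<lambda>_. 1"] by (simp add: add.commute)

text \<open>
  The right-hand side is a sum of products of one factor per edge, so that it can be changed
  edge by edge. It arises by writing the condition that an edge set misses no vertex of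
  \<^term>\<open>V\<close> as a product over the vertices and expanding; \<^term>\<open>S\<close> is then a set of missed
  vertices.
\<close>

lemma edge_cover_poly_inclusion_exclusion:
  assumes "finite V" and "finite E"
  shows "poly (edge_cover_poly V E ends) z =
    (\<Sum>S\<in>Pow V. (-1) ^ card S * (\<Prod>e\<in>E. 1 + (if ends e \<inter> S = {} then z else 0)))"
proof -
  let ?U = "\<lambda>F. \<Union>e\<in>F. ends e"
  have cover: "(\<Sum>S\<in>Pow V. if ?U F \<inter> S = {} then (-1) ^ card S else 0)
      = (if V \<subseteq> ?U F then 1 else (0::complex))" (is "?L = ?R") for F
  proof -
    have "?L = (\<Sum>S\<in>Pow V. \<Prod>v\<in>S. if v \<in> ?U F then 0 else -1)"
    proof (rule sum.cong[OF refl])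
      fix S assume "S \<in> Pow V"
      then have "finite S" using assms(1) finite_subset by auto
      show "(if ?U F \<inter> S = {} then (-1) ^ card S else 0)
        = (\<Prod>v\<in>S. if v \<in> ?U F then 0 else (-1::complex))"
      proof (cases "?U F \<inter> S = {}")
        case True
        then have "(\<Prod>v\<in>S. if v \<in> ?U F then 0 else (-1::complex)) = (\<Prod>v\<in>S. -1)"
          by (intro prod.cong) auto
        then show ?thesis using True by simp
      next
        case False
        then have "\<exists>v\<in>S. (if v \<in> ?U F then 0 else (-1::complex)) = 0" by auto
        then show ?thesis using False \<open>finite S\<close> by (subst prod_zero) auto
      qed
    qed
    also have "\<dots> = (\<Prod>v\<in>V. 1 + (if v \<in> ?U F then 0 else -1))"
      by (rule sum_Pow_prod[OF assms(1)])
    also have "\<dots> = ?R"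
    proof (cases "V \<subseteq> ?U F")
      case True
      then have "(\<Prod>v\<in>V. 1 + (if v \<in> ?U F then 0 else (-1::complex))) = (\<Prod>v\<in>V. 1)"
        by (intro prod.cong) auto
      then show ?thesis using True by simp
    next
      case False
      then have "\<exists>v\<in>V. 1 + (if v \<in> ?U F then 0 else (-1::complex)) = 0" by auto
      then show ?thesis using False assms(1) by (subst prod_zero) auto
    qed
    finally show ?thesis .
  qed
  have edges: "(\<Prod>e\<in>E. 1 + (if ends e \<inter> S = {} then z else 0))
      = (\<Sum>F\<in>Pow E. if ?U F \<inter> S = {} then z ^ card F else 0)" for S
  proof -
    have "(\<Prod>e\<in>E. 1 + (if ends e \<inter> S = {} then z else 0))
      = (\<Sum>F\<in>Pow E. \<Prod>e\<in>F. if ends e \<inter> S = {} then z else 0)"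
      by (rule sum_Pow_prod[OF assms(2), symmetric])
    also have "\<dots> = (\<Sum>F\<in>Pow E. if ?U F \<inter> S = {} then z ^ card F else 0)"
    proof (rule sum.cong[OF refl])
      fix F assume "F \<in> Pow E"
      then have "finite F" using assms(2) finite_subset by auto
      show "(\<Prod>e\<in>F. if ends e \<inter> S = {} then z else 0)
        = (if ?U F \<inter> S = {} then z ^ card F else 0)"
      proof (cases "?U F \<inter> S = {}")
        case True
        then have "(\<Prod>e\<in>F. if ends e \<inter> S = {} then z else 0) = (\<Prod>e\<in>F. z)"
          by (intro prod.cong) auto
        then show ?thesis using True by simp
      next
        case False
        then have "\<exists>e\<in>F. (if ends e \<inter> S = {} then z else 0) = 0" by auto
        then show ?thesis using False \<open>finite F\<close> by (subst prod_zero) auto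
      qed
    qed
    finally show ?thesis .
  qed
  have "(\<Sum>S\<in>Pow V. (-1) ^ card S * (\<Prod>e\<in>E. 1 + (if ends e \<inter> S = {} then z else 0)))
    = (\<Sum>S\<in>Pow V. \<Sum>F\<in>Pow E. z ^ card F * (if ?U F \<inter> S = {} then (-1) ^ card S else 0))"
    unfolding edges sum_distrib_left by (intro sum.cong) auto
  also have "\<dots> = (\<Sum>F\<in>Pow E. \<Sum>S\<in>Pow V. z ^ card F * (if ?U F \<inter> S = {} then (-1) ^ card S else 0))"
    by (rule sum.swap)
  also have "\<dots> = (\<Sum>F\<in>Pow E. z ^ card F * (if V \<subseteq> ?U F then 1 else 0))"
    by (simp only: sum_distrib_left[symmetric] cover)
  also have "\<dots> = (\<Sum>F\<in>Pow E. if edge_cover V E ends F then z ^ card F else 0)"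
    by (intro sum.cong) (auto simp: edge_cover_def)
  also have "\<dots> = (\<Sum>F | edge_cover V E ends F. z ^ card F)"
    using assms(2) by (subst sum.inter_filter[symmetric])
      (auto simp: edge_cover_def intro!: sum.cong)
  also have "\<dots> = poly (edge_cover_poly V E ends) z"
    by (simp add: edge_cover_poly_def poly_sum poly_monom)
  finally show ?thesis by simp
qed

section \<open>Values at 0 and 1 of a polynomial without zeros in the unit disc\<close>

text \<open>
  The factor that a root \<^term>\<open>r\<close> outside the open unit disc contributes to the quotient of the
  values at 1 and at 0. The disc of radius 1 around 1 touches the circle of radius 2 around 0 only
  in the point 2, which is the case \<^prop>\<open>r = -1\<close>.
\<close>

lemma root_factor:
  fixes r :: complex assumes "norm r \<ge> 1"
  shows "norm (1 - 1/r) \<le> 2" and "norm (1 - 1/r) = 2 \<Longrightarrow> 1 - 1/r = 2"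
proof -
  define w where "w = 1/r"
  have w: "norm w \<le> 1" using assms unfolding w_def by (simp add: norm_divide divide_simps)
  show "norm (1 - 1/r) \<le> 2"
    using norm_triangle_ineq4[of 1 w] w unfolding w_def[symmetric] by simp
  assume "norm (1 - 1/r) = 2"
  then have 2: "norm (1 - w) = 2" by (simp add: w_def)
  have "(norm (1 - w))^2 = 1 - 2 * Re w + (norm w)^2"
    unfolding cmod_power2 by (simp add: power2_eq_square algebra_simps)
  moreover have "(norm w)^2 \<le> 1" using w by (simp add: power_le_one)
  ultimately have "Re w \<le> -1" using 2 by simp
  moreover have "\<bar>Re w\<bar> \<le> norm w" by (rule abs_Re_le_cmod)
  ultimately have "Re w = -1" "norm w = 1" using w by auto
  then have "Im w = 0" using cmod_power2[of w] by simp
  then have "w = -1" using \<open>Re w = -1\<close> by (simp add: complex_eq_iff)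
  then show "1 - 1/r = 2" by (simp add: w_def)
qed

text \<open>
  The quotient of the two values is the product of \<^term>\<open>1 - 1 / r\<close> over the roots
  \<^term>\<open>r\<close>, and none of these factors is larger than 2 in modulus. The case of equality is
  what isolates \<open>-(2 ^ k)\<close> as the only exceptional point of the circle of radius \<open>2 ^ k\<close>.
\<close>

lemma zero_free_disc_ratio:
  fixes p :: "complex poly"
  assumes "degree p \<le> k" and "\<And>b. norm b < 1 \<Longrightarrow> poly p b \<noteq> 0"
  obtains c where "poly p 1 = c * poly p 0" "norm c \<le> 2 ^ k" "norm c = 2 ^ k \<Longrightarrow> c = 2 ^ k"
  using assms
proof (induction k arbitrary: p thesis)
  case 0
  then obtain a where "p = [:a:]" by (auto elim: degree_eq_zeroE)
  then show ?case using "0.prems"(1)[of 1] by simp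
next
  case (Suc k)
  show ?case
  proof (cases "degree p = 0")
    case True
    then obtain a where "p = [:a:]" by (auto elim: degree_eq_zeroE)
    moreover have "(2::real) ^ Suc k > 1" by (rule one_less_power) auto
    ultimately show ?thesis using Suc.prems(1)[of 1] by simp
  next
    case False
    then obtain r where "poly p r = 0"
      using fundamental_theorem_of_algebra[of p] constant_degree[of p] by auto
    then have r: "norm r \<ge> 1" using Suc.prems(3)[of r] by force
    obtain q where q: "p = [:-r, 1:] * q"
      using \<open>poly p r = 0\<close> by (auto simp: poly_eq_0_iff_dvd dvd_def)
    have "p \<noteq> 0" using False by auto
    then have "q \<noteq> 0" using q by auto
    then have "degree p = Suc (degree q)" unfolding q by (subst degree_mult_eq) auto
    then have "degree q \<le> k" using Suc.prems(2) by simp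
    moreover have "poly q b \<noteq> 0" if "norm b < 1" for b
      using Suc.prems(3)[OF that] q by auto
    ultimately obtain c where c: "poly q 1 = c * poly q 0" "norm c \<le> 2 ^ k"
        "norm c = 2 ^ k \<Longrightarrow> c = 2 ^ k"
      using Suc.IH by blast
    define d where "d = 1 - 1/r"
    have d: "norm d \<le> 2" "norm d = 2 \<Longrightarrow> d = 2"
      unfolding d_def using root_factor[OF r] by auto
    have "r \<noteq> 0" using r by auto
    then have "poly p 1 = (d * c) * poly p 0"
      using c(1) by (simp add: q d_def field_simps)
    moreover have "norm (d * c) \<le> 2 ^ Suc k"
      using mult_mono[OF d(1) c(2)] by (simp add: norm_mult)
    moreover have "d * c = 2 ^ Suc k" if "norm (d * c) = 2 ^ Suc k"
    proof -
      have *: "norm d * norm c = 2 * 2 ^ k" using that by (simp add: norm_mult)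
      have "norm d * norm c \<le> norm d * 2 ^ k" using c(2) by (simp add: mult_left_mono)
      then have "norm d \<ge> 2" using * by simp
      then have "norm d = 2" using d by simp
      then show ?thesis using * c(3) d(2) by simp
    qed
    ultimately show ?thesis by (rule Suc.prems(1))
  qed
qed

section \<open>Nonvanishing away from \<open>-(2 ^ k)\<close>\<close>

text \<open>
  The heart of the argument on and outside the circle. The edges in \<^term>\<open>R\<close> already carry their
  factor in the inclusion-exclusion formula, and every other edge \<^term>\<open>e\<close> carries a parameter
  \<^term>\<open>a e\<close> of the open unit disc, raised to the number of its vertices in \<^term>\<open>S\<close>.
  While \<^term>\<open>R\<close> is empty, the sum factors over the vertices, and each factor is 1 minus a
  nonempty product of numbers in the open unit disc. To move an edge into \<^term>\<open>R\<close>, regard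
  the sum as a polynomial \<^term>\<open>q\<close> in the parameter of this edge. It has no zero in the
  unit disc by induction. The value at 0 keeps the sets \<^term>\<open>S\<close> disjoint from the edge and the
  value at 1 keeps all of them, so the new sum is \<^term>\<open>poly q 1 + z * poly q 0\<close>.
\<close>

lemma partially_contracted_sum_nonzero:
  fixes z :: complex
  assumes V: "finite V" and E: "finite E" and ends: "\<And>e. e \<in> E \<Longrightarrow> ends e \<subseteq> V"
    and covered: "\<And>v. v \<in> V \<Longrightarrow> \<exists>e\<in>E. v \<in> ends e"
    and size: "\<And>e. e \<in> E \<Longrightarrow> card (ends e) \<le> k"
    and z: "norm z \<ge> 2 ^ k" "z \<noteq> - (2 ^ k)"
    and "R \<subseteq> E" and "\<And>e. e \<in> E - R \<Longrightarrow> norm (a e) < 1"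
  shows "(\<Sum>S\<in>Pow V. (-1) ^ card S * (\<Prod>e\<in>R. 1 + (if ends e \<inter> S = {} then z else 0))
            * (\<Prod>e\<in>E - R. a e ^ card (ends e \<inter> S))) \<noteq> 0"
proof -
  have "finite R" using \<open>R \<subseteq> E\<close> E finite_subset by auto
  then show ?thesis using assms(8-9)
  proof (induction R arbitrary: a rule: finite_induct)
    case empty
    have "(\<Prod>e\<in>E. a e ^ card (ends e \<inter> S)) = (\<Prod>v\<in>S. \<Prod>e\<in>{e\<in>E. v \<in> ends e}. a e)"
      if "S \<subseteq> V" for S
    proof -
      have "finite S" using that V finite_subset by auto
      have "(\<Prod>e\<in>E. a e ^ card (ends e \<inter> S)) = (\<Prod>e\<in>E. \<Prod>v\<in>{v\<in>S. v \<in> ends e}. a e)"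
        by (intro prod.cong refl) (simp add: Int_def conj_commute)
      also have "\<dots> = (\<Prod>v\<in>S. \<Prod>e\<in>{e\<in>E. v \<in> ends e}. a e)"
        using E \<open>finite S\<close> by (rule prod.swap_restrict)
      finally show ?thesis .
    qed
    then have "(\<Sum>S\<in>Pow V. (-1) ^ card S * (\<Prod>e\<in>E. a e ^ card (ends e \<inter> S)))
      = (\<Sum>S\<in>Pow V. \<Prod>v\<in>S. - (\<Prod>e\<in>{e\<in>E. v \<in> ends e}. a e))"
      by (intro sum.cong refl) (simp add: prod_uminus)
    also have "\<dots> = (\<Prod>v\<in>V. 1 - (\<Prod>e\<in>{e\<in>E. v \<in> ends e}. a e))"
      by (subst sum_Pow_prod[OF V]) simp
    also have "\<dots> \<noteq> 0"
    proof -
      have "(\<Prod>e\<in>{e\<in>E. v \<in> ends e}. a e) \<noteq> 1" if v: "v \<in> V" for v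
      proof -
        obtain f where "f \<in> E" "v \<in> ends f" using covered[OF v] by blast
        then have "(\<Prod>e\<in>{e\<in>E. v \<in> ends e}. norm (a e)) < (\<Prod>e\<in>{e\<in>E. v \<in> ends e}. 1)"
          using E empty.prems(2) by (intro prod_mono_strict[of f]) (auto intro: less_imp_le)
        then have "norm (\<Prod>e\<in>{e\<in>E. v \<in> ends e}. a e) < 1" by (simp add: prod_norm)
        then show ?thesis by force
      qed
      then show ?thesis using V by auto
    qed
    finally show ?case by simp
  next
    case (insert e R)
    then have e: "e \<in> E" "e \<notin> R" and ER: "E - R = insert e (E - insert e R)" by auto
    define W where "W S = (-1) ^ card S * (\<Prod>e\<in>R. 1 + (if ends e \<inter> S = {} then z else 0))
            * (\<Prod>e\<in>E - insert e R. a e ^ card (ends e \<inter> S))" for S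
    define q where "q = (\<Sum>S\<in>Pow V. monom (W S) (card (ends e \<inter> S)))"
    have "finite (ends e)" using ends[OF e(1)] V finite_subset by auto
    have q: "poly q b = (\<Sum>S\<in>Pow V. W S * b ^ card (ends e \<inter> S))" for b
      by (simp add: q_def poly_sum poly_monom)
    have "degree q \<le> k" unfolding q_def
    proof (rule degree_sum_le)
      show "finite (Pow V)" using V by simp
      fix S
      have "card (ends e \<inter> S) \<le> card (ends e)"
        using \<open>finite (ends e)\<close> by (intro card_mono) auto
      then show "degree (monom (W S) (card (ends e \<inter> S))) \<le> k"
        using size[OF e(1)] by (intro order_trans[OF degree_monom_le]) simp
    qed
    moreover have "poly q b \<noteq> 0" if "norm b < 1" for b
    proof -
      have "(\<Prod>f\<in>E - R. (a(e := b)) f ^ card (ends f \<inter> S))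
        = b ^ card (ends e \<inter> S) * (\<Prod>f\<in>E - insert e R. a f ^ card (ends f \<inter> S))" for S
      proof -
        have "(\<Prod>f\<in>E - R. (a(e := b)) f ^ card (ends f \<inter> S))
          = (a(e := b)) e ^ card (ends e \<inter> S)
             * (\<Prod>f\<in>E - insert e R. (a(e := b)) f ^ card (ends f \<inter> S))"
          unfolding ER using E by (intro prod.insert) auto
        also have "(\<Prod>f\<in>E - insert e R. (a(e := b)) f ^ card (ends f \<inter> S))
          = (\<Prod>f\<in>E - insert e R. a f ^ card (ends f \<inter> S))"
          by (intro prod.cong) auto
        finally show ?thesis by simp
      qed
      then have "poly q b = (\<Sum>S\<in>Pow V. (-1) ^ card S
            * (\<Prod>e\<in>R. 1 + (if ends e \<inter> S = {} then z else 0))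
            * (\<Prod>f\<in>E - R. (a(e := b)) f ^ card (ends f \<inter> S)))"
        unfolding q W_def by (intro sum.cong refl) (simp only: mult_ac)
      also have "\<dots> \<noteq> 0" using insert that by (intro insert.IH) auto
      finally show ?thesis .
    qed
    ultimately obtain c where c: "poly q 1 = c * poly q 0" "norm c \<le> 2 ^ k"
        "norm c = 2 ^ k \<Longrightarrow> c = 2 ^ k"
      using zero_free_disc_ratio[of q k] by blast
    have "poly q 0 \<noteq> 0" using \<open>\<And>b. norm b < 1 \<Longrightarrow> poly q b \<noteq> 0\<close> by simp
    moreover have "c + z \<noteq> 0"
    proof
      assume "c + z = 0"
      then have "z = - c" by (simp add: eq_neg_iff_add_eq_0 add.commute)
      then show False using z c by auto
    qed
    ultimately have "poly q 1 + z * poly q 0 \<noteq> 0"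
      unfolding c(1) by (simp add: distrib_right[symmetric])
    also have "poly q 1 + z * poly q 0
      = (\<Sum>S\<in>Pow V. W S * (1 + (if ends e \<inter> S = {} then z else 0)))"
      unfolding q sum_distrib_left sum.distrib[symmetric]
      using \<open>finite (ends e)\<close> by (intro sum.cong) (auto simp: power_0_left algebra_simps)
    also have "\<dots> = (\<Sum>S\<in>Pow V. (-1) ^ card S
            * (\<Prod>e\<in>insert e R. 1 + (if ends e \<inter> S = {} then z else 0))
            * (\<Prod>e\<in>E - insert e R. a e ^ card (ends e \<inter> S)))"
      unfolding W_def prod.insert[OF insert.hyps] by (intro sum.cong refl) (simp only: mult_ac)
    finally show ?case .
  qed
qed

section \<open>Fourier coefficients at \<open>-(2 ^ k)\<close>\<close>

text \<open>
  A character, in the variable \<^term>\<open>S\<close>, of the group of finite sets of vertices under symmetric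
  difference.
\<close>

definition character :: "'v set \<Rightarrow> 'v set \<Rightarrow> real" where
  "character \<tau> S = (-1) ^ card (\<tau> \<inter> S)"

lemma character_commute: "character \<tau> S = character S \<tau>"
  by (simp add: character_def Int_commute)

lemma character_eq_prod:
  assumes "finite S"
  shows "character \<tau> S = (\<Prod>v\<in>S. if v \<in> \<tau> then -1 else 1)"
  using assms by (simp add: character_def prod.If_cases Int_commute Int_def[symmetric])

lemma character_sym_diff:
  assumes "finite S"
  shows "character (sym_diff \<tau> A) S = character \<tau> S * character A S"
  unfolding character_eq_prod[OF assms] prod.distrib[symmetric] by (intro prod.cong) auto

lemma sum_character_Pow:
  assumes "finite A"
  shows "(\<Sum>S\<in>Pow A. character \<tau> S) = (if A \<inter> \<tau> = {} then 2 ^ card A else 0)"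
proof -
  have "(\<Sum>S\<in>Pow A. character \<tau> S) = (\<Sum>S\<in>Pow A. \<Prod>v\<in>S. if v \<in> \<tau> then -1 else 1)"
    using assms finite_subset by (intro sum.cong refl character_eq_prod) auto
  also have "\<dots> = (\<Prod>v\<in>A. 1 + (if v \<in> \<tau> then -1 else 1))"
    by (rule sum_Pow_prod[OF assms])
  also have "\<dots> = (if A \<inter> \<tau> = {} then 2 ^ card A else 0)"
  proof (cases "A \<inter> \<tau> = {}")
    case True
    then have "(\<Prod>v\<in>A. 1 + (if v \<in> \<tau> then -1 else (1::real))) = (\<Prod>v\<in>A. 2)"
      by (intro prod.cong) auto
    then show ?thesis using True by simp
  next
    case False
    then have "\<exists>v\<in>A. 1 + (if v \<in> \<tau> then -1 else (1::real)) = 0" by auto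
    then show ?thesis using False assms by (subst prod_zero) auto
  qed
  finally show ?thesis .
qed

text \<open>
  Up to the factor \<open>2 ^ card V\<close>, the Fourier coefficient at \<^term>\<open>\<tau>\<close> of the product of
  the negated edge factors at \<open>z = -(2 ^ k)\<close>. The negation makes all coefficients
  nonnegative if no edge has more than \<^term>\<open>k\<close> vertices.
  Since \<^term>\<open>character V S\<close> is \<open>(-1) ^ card S\<close> for \<^prop>\<open>S \<subseteq> V\<close>, the choice
  \<open>\<tau> = V\<close> and \<open>F = E\<close> yields the edge cover polynomial up to sign.
\<close>

definition fourier_coeff :: "'v set \<Rightarrow> ('e \<Rightarrow> 'v set) \<Rightarrow> nat \<Rightarrow> 'e set \<Rightarrow> 'v set \<Rightarrow> real" where
  "fourier_coeff V ends k F \<tau> = (\<Sum>S\<in>Pow V. character \<tau> S *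
     (\<Prod>e\<in>F. (if ends e \<inter> S = {} then 2 ^ k else 0) - 1))"

lemma fourier_coeff_empty:
  assumes "finite V"
  shows "fourier_coeff V ends k {} \<tau> = (if V \<inter> \<tau> = {} then 2 ^ card V else 0)"
  using sum_character_Pow[OF assms] by (simp add: fourier_coeff_def)

text \<open>
  The indicator of \<^prop>\<open>ends e \<inter> S = {}\<close> is the average over \<^prop>\<open>A \<subseteq> ends e\<close> of
  \<^term>\<open>character A S\<close>, and multiplication by a character translates the Fourier coefficients.
\<close>

lemma fourier_coeff_insert:
  assumes "finite V" "finite F" "e \<notin> F" "finite (ends e)" "card (ends e) \<le> k"
  shows "fourier_coeff V ends k (insert e F) \<tau> =
    2 ^ (k - card (ends e)) * (\<Sum>A\<in>Pow (ends e). fourier_coeff V ends k F (sym_diff \<tau> A))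
      - fourier_coeff V ends k F \<tau>"
proof -
  define W where "W S = (\<Prod>e\<in>F. (if ends e \<inter> S = {} then 2 ^ k else 0) - (1::real))" for S
  have edge: "(if ends e \<inter> S = {} then 2 ^ k else (0::real))
     = 2 ^ (k - card (ends e)) * (\<Sum>A\<in>Pow (ends e). character A S)" for S
  proof -
    have "(\<Sum>A\<in>Pow (ends e). character A S) = (\<Sum>A\<in>Pow (ends e). character S A)"
      by (simp add: character_commute)
    then show ?thesis
      using assms(5) by (simp add: sum_character_Pow[OF assms(4)] power_add[symmetric])
  qed
  have "fourier_coeff V ends k (insert e F) \<tau> = (\<Sum>S\<in>Pow V. 2 ^ (k - card (ends e)) *
      (\<Sum>A\<in>Pow (ends e). character \<tau> S * character A S * W S) - character \<tau> S * W S)"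
    unfolding fourier_coeff_def prod.insert[OF assms(2,3)] edge
    by (intro sum.cong refl) (simp add: W_def[symmetric] sum_distrib_left[symmetric]
        sum_distrib_right[symmetric] algebra_simps)
  also have "\<dots> = 2 ^ (k - card (ends e)) *
      (\<Sum>S\<in>Pow V. \<Sum>A\<in>Pow (ends e). character (sym_diff \<tau> A) S * W S)
      - (\<Sum>S\<in>Pow V. character \<tau> S * W S)"
  proof -
    have "character (sym_diff \<tau> A) S = character \<tau> S * character A S" if "S \<in> Pow V" for A S
      using that assms(1) finite_subset by (intro character_sym_diff) auto
    then show ?thesis by (simp add: sum_subtractf sum_distrib_left)
  qed
  finally show ?thesis
    by (subst (asm) sum.swap) (simp add: fourier_coeff_def W_def)
qed

lemma sum_minus_single_ge:
  fixes f :: "'a \<Rightarrow> real"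
  assumes "finite I" "i \<in> I" "j \<in> I" "i \<noteq> j" and "\<And>x. x \<in> I \<Longrightarrow> f x \<ge> 0" and "c \<ge> 1"
  shows "f j \<le> c * sum f I - f i"
proof -
  have "f i + f j = sum f {i, j}" using assms(4) by simp
  also have "\<dots> \<le> sum f I" using assms by (intro sum_mono2) auto
  also have "\<dots> \<le> c * sum f I"
    using mult_right_mono[OF assms(6) sum_nonneg[OF assms(5)]] by simp
  finally show ?thesis by simp
qed

text \<open>
  The subtracted term of the recursion is also the summand for the empty set, whose coefficient
  \<open>2 ^ (k - card (ends e))\<close> is at least 1.
\<close>

lemma fourier_coeff_nonneg:
  assumes "finite V" "finite F" and "\<And>e. e \<in> F \<Longrightarrow> finite (ends e) \<and> card (ends e) \<le> k"
  shows "fourier_coeff V ends k F \<tau> \<ge> 0"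
  using assms(2,3)
proof (induction F arbitrary: \<tau> rule: finite_induct)
  case empty
  then show ?case by (simp add: fourier_coeff_empty[OF assms(1)])
next
  case (insert e F)
  let ?f = "\<lambda>A. fourier_coeff V ends k F (sym_diff \<tau> A)"
  have pos: "?f A \<ge> 0" for A using insert by auto
  have fin: "finite (ends e)" using insert by auto
  have "?f {} \<le> sum ?f (Pow (ends e))"
    using fin pos by (intro member_le_sum) auto
  also have "\<dots> \<le> 2 ^ (k - card (ends e)) * sum ?f (Pow (ends e))"
    using mult_right_mono[of 1 "2 ^ (k - card (ends e))", OF _ sum_nonneg[of "Pow (ends e)" ?f]] pos
    by simp
  finally show ?case
    using insert assms(1) by (subst fourier_coeff_insert) auto
qed

text \<open>
  The subtraction cancels at most one copy of the summand for the empty set. A nonempty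
  \<^term>\<open>A\<close> is therefore untouched, and for an edge of size less than \<^term>\<open>k\<close> the summand
  for the empty set occurs at least twice.
\<close>

lemma fourier_coeff_insert_ge:
  assumes V: "finite V" and F: "finite F" "e \<notin> F"
    and size: "\<And>f. f \<in> insert e F \<Longrightarrow> finite (ends f) \<and> card (ends f) \<le> k"
    and A: "A \<subseteq> ends e" "A \<noteq> {} \<or> card (ends e) < k"
  shows "fourier_coeff V ends k F (sym_diff \<tau> A) \<le> fourier_coeff V ends k (insert e F) \<tau>"
proof -
  let ?f = "\<lambda>A. fourier_coeff V ends k F (sym_diff \<tau> A)"
  let ?c = "(2::real) ^ (k - card (ends e))"
  have pos: "?f A \<ge> 0" for A using V F size by (intro fourier_coeff_nonneg) auto
  have fin: "finite (ends e)" using size by auto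
  have "?f A \<le> ?c * sum ?f (Pow (ends e)) - ?f {}"
  proof (cases "A = {}")
    case False
    then show ?thesis using fin A(1) pos by (intro sum_minus_single_ge) auto
  next
    case True
    then obtain d where "k - card (ends e) = Suc d" using A(2) by (auto dest: less_imp_Suc_add)
    then have "?c \<ge> 2" by simp
    have "2 * ?f {} \<le> 2 * sum ?f (Pow (ends e))"
      using fin pos by (intro mult_left_mono member_le_sum) auto
    also have "\<dots> \<le> ?c * sum ?f (Pow (ends e))"
      using \<open>?c \<ge> 2\<close> pos by (intro mult_right_mono sum_nonneg) auto
    finally show ?thesis using True by simp
  qed
  also have "\<dots> = fourier_coeff V ends k (insert e F) \<tau>"
    using V F size by (subst fourier_coeff_insert) auto
  finally show ?thesis .
qed

section \<open>Covering every vertex an odd number of times\<close>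

text \<open>
  \<^term>\<open>\<tau>\<close> is the set of the vertices covered an odd number of times when a subset
  \<^term>\<open>A\<close> of each edge of \<^term>\<open>F\<close> is selected. For \<open>k \<ge> 2\<close> the permitted subsets are among
  those that contribute to the Fourier coefficients: the empty set is permitted only for an edge
  with a single vertex, whose size is then less than \<^term>\<open>k\<close>.
\<close>

inductive parity_pattern :: "('e \<Rightarrow> 'v set) \<Rightarrow> 'e set \<Rightarrow> 'v set \<Rightarrow> bool" for ends where
  empty: "parity_pattern ends {} {}"
| insert: "parity_pattern ends F (sym_diff \<tau> A) \<Longrightarrow> e \<notin> F \<Longrightarrow> A \<subseteq> ends e \<Longrightarrow>
    A \<noteq> {} \<or> card (ends e) = 1 \<Longrightarrow> parity_pattern ends (insert e F) \<tau>"

lemma fourier_coeff_pos: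
  assumes "parity_pattern ends F \<tau>" and "finite V" "k \<ge> 2"
    and "\<And>e. e \<in> F \<Longrightarrow> finite (ends e) \<and> card (ends e) \<le> k"
  shows "finite F \<and> fourier_coeff V ends k F \<tau> > 0"
  using assms(1,4)
proof (induction rule: parity_pattern.induct)
  case empty
  then show ?case by (simp add: fourier_coeff_empty[OF assms(2)])
next
  case (insert F \<tau> A e)
  then have "finite F" "fourier_coeff V ends k F (sym_diff \<tau> A) > 0" by auto
  moreover have "fourier_coeff V ends k F (sym_diff \<tau> A) \<le> fourier_coeff V ends k (insert e F) \<tau>"
    using insert assms(2,3) \<open>finite F\<close> by (intro fourier_coeff_insert_ge) auto
  ultimately show ?case by simp
qed

text \<open>
  A connected piece \<^term>\<open>X\<close> admits every parity condition except at most one, here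
  \<^term>\<open>\<beta>\<close>; for a tree of edges of size two there is such an exception. An edge \<^term>\<open>e\<close>
  that meets the piece keeps this so. Its selected subset \<^term>\<open>A\<close> is prescribed on the set
  \<^term>\<open>B\<close> of its new vertices and free elsewhere. If two choices of \<^term>\<open>A\<close> are permitted,
  at least one of them avoids \<^term>\<open>\<beta>\<close>. A single choice may remain only if there are new
  vertices and none of them is to be covered an odd number of times; then \<^term>\<open>A\<close> must be a
  nonempty set of old vertices, and taking \<^term>\<open>{c}\<close> moves the exception to
  \<^term>\<open>sym_diff \<beta> {c}\<close>. In particular, the condition that all vertices of the enlarged piece
  are covered an odd number of times is never the exception. The set \<^term>\<open>Y\<close> collects the
  pieces that are already finished.
\<close>

lemma parity_pattern_grow:
  assumes e: "e \<notin> F" "ends e \<inter> Y = {}" and "X \<inter> Y = {}" and c: "c \<in> ends e" "c \<in> X"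
    and good: "\<And>\<tau>. \<tau> \<subseteq> X \<Longrightarrow> \<tau> \<noteq> \<beta> \<Longrightarrow> parity_pattern ends F (Y \<union> \<tau>)"
  obtains \<beta>' where
    "\<And>\<tau>. \<tau> \<subseteq> X \<union> ends e \<Longrightarrow> \<tau> \<noteq> \<beta>' \<Longrightarrow> parity_pattern ends (insert e F) (Y \<union> \<tau>)"
    and "parity_pattern ends (insert e F) (Y \<union> (X \<union> ends e))"
proof -
  define B where "B = ends e - X"
  have step: "parity_pattern ends (insert e F) (Y \<union> \<tau>)"
    if "\<tau> \<subseteq> X \<union> ends e" "A \<subseteq> ends e" "A \<noteq> {} \<or> card (ends e) = 1" "A \<inter> B = \<tau> \<inter> B"
      "sym_diff \<tau> A \<noteq> \<beta>" for \<tau> A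
  proof -
    have "sym_diff \<tau> A \<subseteq> X" using that unfolding B_def by blast
    then have "parity_pattern ends F (Y \<union> sym_diff \<tau> A)" using good that by blast
    moreover have "Y \<union> sym_diff \<tau> A = sym_diff (Y \<union> \<tau>) A" using that e by blast
    ultimately show ?thesis using that e by (intro parity_pattern.insert[where A = A]) auto
  qed
  have two: "parity_pattern ends (insert e F) (Y \<union> \<tau>)"
    if "\<tau> \<subseteq> X \<union> ends e" "A \<subseteq> ends e" "A \<noteq> {} \<or> card (ends e) = 1" "A \<inter> B = \<tau> \<inter> B"
      "A' \<subseteq> ends e" "A' \<noteq> {} \<or> card (ends e) = 1" "A' \<inter> B = \<tau> \<inter> B" "A \<noteq> A'" for \<tau> A A'
  proof (cases "sym_diff \<tau> A = \<beta>")
    case True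
    then have "sym_diff \<tau> A' \<noteq> \<beta>" using \<open>A \<noteq> A'\<close> by blast
    then show ?thesis using step that by blast
  next
    case False
    then show ?thesis using step that by blast
  qed
  have new: "parity_pattern ends (insert e F) (Y \<union> \<tau>)"
    if "\<tau> \<subseteq> X \<union> ends e" "\<tau> \<inter> B \<noteq> {}" for \<tau>
    using that c by (intro two[of \<tau> "\<tau> \<inter> B" "insert c (\<tau> \<inter> B)"]) (auto simp: B_def)
  have old: "parity_pattern ends (insert e F) (Y \<union> \<tau>)"
    if "\<tau> \<subseteq> X \<union> ends e" "B = {}" for \<tau>
  proof (cases "ends e = {c}")
    case True
    then show ?thesis using that by (intro two[of \<tau> "{}" "{c}"]) auto
  next
    case False
    then obtain d where "d \<in> ends e" "d \<noteq> c" using c by blast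
    then show ?thesis using that c by (intro two[of \<tau> "{d}" "{c}"]) auto
  qed
  show thesis
  proof
    fix \<tau> assume \<tau>: "\<tau> \<subseteq> X \<union> ends e" "\<tau> \<noteq> sym_diff \<beta> {c}"
    show "parity_pattern ends (insert e F) (Y \<union> \<tau>)"
    proof (cases "\<tau> \<inter> B = {}")
      case True
      moreover have "sym_diff \<tau> {c} \<noteq> \<beta>" using \<tau>(2) by blast
      ultimately show ?thesis using \<tau> c by (intro step[of \<tau> "{c}"]) (auto simp: B_def)
    qed (use new \<tau> in blast)
  next
    show "parity_pattern ends (insert e F) (Y \<union> (X \<union> ends e))"
    proof (cases "B = {}")
      case True
      then show ?thesis using old by blast
    next
      case False
      then show ?thesis by (intro new) (auto simp: B_def)
    qed
  qed
qed

text \<open>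
  Exhaustion of the hypergraph piece by piece. As long as an unused edge meets the current piece
  \<^term>\<open>X\<close>, it is added; otherwise \<^term>\<open>X\<close> is finished, and a new piece starts from a single
  vertex \<^term>\<open>r\<close> of an unused edge.
\<close>

lemma parity_pattern_extend:
  assumes "finite E" and "\<And>e. e \<in> E \<Longrightarrow> ends e \<noteq> {}" and "F \<subseteq> E"
    and "\<And>e. e \<in> E - F \<Longrightarrow> ends e \<inter> Y = {}" and "X \<inter> Y = {}"
    and "\<And>\<tau>. \<tau> \<subseteq> X \<Longrightarrow> \<tau> \<noteq> \<beta> \<Longrightarrow> parity_pattern ends F (Y \<union> \<tau>)"
    and "parity_pattern ends F (Y \<union> X)"
  shows "parity_pattern ends E (Y \<union> X \<union> \<Union> (ends ` (E - F)))"
  using assms(3-)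
proof (induction "card (E - F)" arbitrary: F X Y \<beta> rule: less_induct)
  case less
  have grow: "parity_pattern ends E (Y' \<union> X' \<union> \<Union> (ends ` (E - F)))"
    if e: "e \<in> E - F" and Y': "\<And>f. f \<in> E - F \<Longrightarrow> ends f \<inter> Y' = {}" and "X' \<inter> Y' = {}"
      and c: "c \<in> ends e" "c \<in> X'"
      and good: "\<And>\<tau>. \<tau> \<subseteq> X' \<Longrightarrow> \<tau> \<noteq> \<beta>' \<Longrightarrow> parity_pattern ends F (Y' \<union> \<tau>)"
    for e c X' Y' \<beta>'
  proof -
    obtain \<gamma> where \<gamma>:
      "\<And>\<tau>. \<tau> \<subseteq> X' \<union> ends e \<Longrightarrow> \<tau> \<noteq> \<gamma> \<Longrightarrow> parity_pattern ends (insert e F) (Y' \<union> \<tau>)"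
      "parity_pattern ends (insert e F) (Y' \<union> (X' \<union> ends e))"
      using parity_pattern_grow[of e F ends Y' X' c \<beta>', OF _ Y'[OF e] \<open>X' \<inter> Y' = {}\<close> c good] e
      by blast
    have "card (E - insert e F) < card (E - F)"
      using e \<open>finite E\<close> by (intro psubset_card_mono) auto
    then have "parity_pattern ends E (Y' \<union> (X' \<union> ends e) \<union> \<Union> (ends ` (E - insert e F)))"
      using e less.prems(1) Y' \<open>X' \<inter> Y' = {}\<close> \<gamma>
      by (intro less.hyps[where \<beta> = \<gamma>]) auto
    moreover have "Y' \<union> (X' \<union> ends e) \<union> \<Union> (ends ` (E - insert e F))
      = Y' \<union> X' \<union> \<Union> (ends ` (E - F))" using e by auto
    ultimately show ?thesis by simp
  qed
  consider "F = E" | e c where "e \<in> E - F" "c \<in> ends e" "c \<in> X"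
    | e where "e \<in> E - F" "\<And>f. f \<in> E - F \<Longrightarrow> ends f \<inter> X = {}"
    using less.prems(1) by blast
  then show ?case
  proof cases
    case 1
    then show ?thesis using less.prems by simp
  next
    case 2
    then show ?thesis using less.prems by (intro grow[of e Y X c \<beta>]) auto
  next
    case 3
    then obtain r where r: "r \<in> ends e" using assms(2) by blast
    \<comment> \<open>No edge of the new piece has been used yet, so its only exception is the parity condition
      that asks to cover \<^term>\<open>r\<close> an odd number of times.\<close>
    have "parity_pattern ends E ((Y \<union> X) \<union> {r} \<union> \<Union> (ends ` (E - F)))"
    proof (rule grow[of e _ _ r "{r}"])
      show "ends f \<inter> (Y \<union> X) = {}" if "f \<in> E - F" for f
        using 3(2) less.prems(2) that by blast
      then show "{r} \<inter> (Y \<union> X) = {}" using 3(1) r by blast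
      show "parity_pattern ends F (Y \<union> X \<union> \<tau>)" if "\<tau> \<subseteq> {r}" "\<tau> \<noteq> {r}" for \<tau>
        using that less.prems(5) by (auto dest: subset_singletonD)
    qed (use 3 r in auto)
    moreover have "(Y \<union> X) \<union> {r} \<union> \<Union> (ends ` (E - F)) = Y \<union> X \<union> \<Union> (ends ` (E - F))"
      using 3 r by auto
    ultimately show ?thesis by simp
  qed
qed

lemma parity_pattern_all:
  assumes "finite E" and "\<And>e. e \<in> E \<Longrightarrow> ends e \<noteq> {}"
  shows "parity_pattern ends E (\<Union> (ends ` E))"
  using parity_pattern_extend[of E ends "{}" "{}" "{}" "{undefined}"] assms
  by (auto intro: parity_pattern.empty)

section \<open>Zero-free regions of the edge cover polynomial\<close>

lemma edge_cover_poly_nonzero_off_exceptional_point: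
  assumes "hypergraph V E ends" and "\<forall>v\<in>V. \<not> isolated E ends v"
    and "\<And>e. e \<in> E \<Longrightarrow> card (ends e) \<le> k"
    and "norm z \<ge> 2 ^ k" "z \<noteq> - (2 ^ k)"
  shows "poly (edge_cover_poly V E ends) z \<noteq> 0"
proof -
  interpret hypergraph V E ends by fact
  have "(\<Sum>S\<in>Pow V. (-1) ^ card S * (\<Prod>e\<in>E. 1 + (if ends e \<inter> S = {} then z else 0))
            * (\<Prod>e\<in>E - E. 0 ^ card (ends e \<inter> S))) \<noteq> 0"
    using assms(2) by (intro partially_contracted_sum_nonzero[OF finite_vertices finite_edges
          ends_subset _ assms(3-5)]) (auto simp: isolated_def)
  then show ?thesis
    by (simp add: edge_cover_poly_inclusion_exclusion[OF finite_vertices finite_edges])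
qed

lemma edge_cover_poly_eq_fourier_coeff:
  assumes "finite V" and "finite E"
  shows "poly (edge_cover_poly V E ends) (- (2 ^ k))
    = (-1) ^ card E * of_real (fourier_coeff V ends k E V)"
proof -
  have "(-1) ^ card S * (\<Prod>e\<in>E. 1 + (if ends e \<inter> S = {} then - (2 ^ k) else 0))
    = (-1) ^ card E * complex_of_real (character V S
        * (\<Prod>e\<in>E. (if ends e \<inter> S = {} then 2 ^ k else 0) - 1))"
    if "S \<in> Pow V" for S
  proof -
    have "V \<inter> S = S" using that by auto
    have "(\<Prod>e\<in>E. 1 + (if ends e \<inter> S = {} then - (2 ^ k) else (0::complex)))
      = (\<Prod>e\<in>E. (-1) * complex_of_real ((if ends e \<inter> S = {} then 2 ^ k else 0) - 1))"
      by (intro prod.cong) auto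
    also have "\<dots> = (-1) ^ card E
        * complex_of_real (\<Prod>e\<in>E. (if ends e \<inter> S = {} then 2 ^ k else 0) - 1)"
      by (simp only: prod.distrib prod_constant of_real_prod)
    finally show ?thesis
      by (simp only: character_def \<open>V \<inter> S = S\<close> of_real_mult of_real_power of_real_minus
          of_real_1 mult_ac)
  qed
  then show ?thesis
    unfolding edge_cover_poly_inclusion_exclusion[OF assms] fourier_coeff_def of_real_sum
      sum_distrib_left
    by (intro sum.cong refl) auto
qed

lemma edge_cover_poly_nonzero_exceptional_point:
  assumes "hypergraph V E ends" and "\<forall>v\<in>V. \<not> isolated E ends v"
    and "\<And>e. e \<in> E \<Longrightarrow> card (ends e) \<le> k" and "k \<ge> 2"
  shows "poly (edge_cover_poly V E ends) (- (2 ^ k)) \<noteq> 0"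
proof -
  interpret hypergraph V E ends by fact
  have "\<Union> (ends ` E) = V"
    using ends_subset assms(2) by (auto simp: isolated_def)
  then have "parity_pattern ends E V"
    using parity_pattern_all[of E ends] finite_edges ends_nonempty by simp
  moreover have "finite (ends e)" if "e \<in> E" for e
    using ends_subset[OF that] finite_vertices finite_subset by auto
  ultimately have "fourier_coeff V ends k E V > 0"
    using fourier_coeff_pos[of ends E V V k] finite_vertices assms(3,4) by blast
  then show ?thesis
    by (simp add: edge_cover_poly_eq_fourier_coeff[OF finite_vertices finite_edges])
qed

theorem theorem1p4:
  fixes V :: "'v set" and E :: "'e set" and ends :: "'e \<Rightarrow> 'v set" and k :: nat
  assumes "hypergraph V E ends"
    and "\<forall>v\<in>V. \<not> isolated E ends v"
    and "largest_edge_size E ends k"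
  shows "(\<forall>z::complex. norm z > 2 ^ k \<longrightarrow> poly (edge_cover_poly V E ends) z \<noteq> 0) \<and>
         (k = 2 \<longrightarrow> (\<forall>z::complex. norm z \<ge> 4 \<longrightarrow> poly (edge_cover_poly V E ends) z \<noteq> 0))"
proof (intro conjI allI impI)
  have size: "card (ends e) \<le> k" if "e \<in> E" for e
    using assms(3) that by (auto simp: largest_edge_size_def)
  show "poly (edge_cover_poly V E ends) z \<noteq> 0" if "norm z > 2 ^ k" for z
  proof (rule edge_cover_poly_nonzero_off_exceptional_point[OF assms(1,2) size])
    show "z \<noteq> - (2 ^ k)" using that by (auto simp: norm_power)
  qed (use that in auto)
  show "poly (edge_cover_poly V E ends) z \<noteq> 0" if "k = 2" "norm z \<ge> 4" for z
  proof (cases "z = - (2 ^ k)")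
    case True
    then show ?thesis
      using edge_cover_poly_nonzero_exceptional_point[OF assms(1,2) size] \<open>k = 2\<close> by simp
  next
    case False
    then show ?thesis
      using that
      by (intro edge_cover_poly_nonzero_off_exceptional_point[OF assms(1,2) size]) auto
  qed
qed

end
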